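(* Let $\mathcal{C}=\{K^s_{s,N}: s\in\mathbb{N},\ N\in\mathbb{N}\}$. Then $\mathcal{C}$ is not strongly flip-flat.
   Context: $K_{s,N}$ is the complete bipartite graph with sides of sizes $s$ and $N$. For a graph $G$, $G^s$ denotes its $s$-subdivision: each edge $uv$ is replaced by a path from $u$ to $v$ of length $s+1$ whose internal vertices are new. A set $B$ of vertices is $r$-independent in a graph if its distinct vertices are pairwise at distance $>r$. A flip in $G$ is a pair $(A,B)$ of vertex subsets; $G\oplus(A,B)$ has edge set $E(G)\,\Delta\,((A\times B)\cup(B\times A))$, and $G\oplus\{F_1,\dots,F_k\}=G\oplus F_1\oplus\cdots\oplus F_k$. A class $\mathcal{C}$ is strongly flip-flat if there is an integer $s_0$ such that for every $r\in\mathbb{N}$ there is $N_r:\mathbb{N}\to\mathbb{N}$ such that for all $m\in\mathbb{N}$, all $G\in\mathcal{C}$ and all $A\subseteq V(G)$ with $|A|\ge N_r(m)$ there are a set $\mathcal{F}$ of at most $s_0$ flips and $B\subseteq A$ with $|B|\ge m$ that is $r$-independent in $G\oplus\mathcal{F}$. *)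

theory Defs
  imports "Graph_Theory.Graph_Theory" "HOL-Library.Extended_Nat"
begin

text \<open>
  A graph is a \<^typ>\<open>'a pair_pre_digraph\<close> whose arc set is a symmetric relation; the finite simple
  graphs are those satisfying \<^const>\<open>pair_graph\<close>.
\<close>

definition complete_bipartite :: "nat \<Rightarrow> nat \<Rightarrow> (nat + nat) pair_pre_digraph" where
  "complete_bipartite m n =
    \<lparr> pverts = Inl ` {..<m} \<union> Inr ` {..<n},
      parcs = (Inl ` {..<m}) \<times> (Inr ` {..<n}) \<union> (Inr ` {..<n}) \<times> (Inl ` {..<m}) \<rparr>"

lemma complete_bipartite_digraph_complete_bipartite:
  "complete_bipartite_digraph m n (with_proj (complete_bipartite m n))"
  unfolding complete_bipartite_digraph_pair_def
  by (intro conjI exI[of _ "Inl ` {..<m}"] exI[of _ "Inr ` {..<n}"])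
    (auto simp: complete_bipartite_def card_image)

datatype 'a subdiv_vertex = Orig 'a | Inner "('a \<times> 'a \<times> nat) set"

text \<open>
  \<open>subdiv_point s u v i\<close> is the vertex at position \<open>i\<close> on the path of length \<open>s + 1\<close> from \<open>u\<close> to \<open>v\<close>
  replacing the edge \<open>uv\<close>. An inner vertex is named by both of its positions, as seen from \<open>u\<close> and as
  seen from \<open>v\<close>, so that the arcs \<open>(u, v)\<close> and \<open>(v, u)\<close> yield the same path.
\<close>

definition subdiv_point :: "nat \<Rightarrow> 'a \<Rightarrow> 'a \<Rightarrow> nat \<Rightarrow> 'a subdiv_vertex" where
  "subdiv_point s u v i =
    (if i = 0 then Orig u
     else if i = s + 1 then Orig v
     else Inner {(u, v, i), (v, u, s + 1 - i)})"

definition s_subdivision :: "nat \<Rightarrow> 'a pair_pre_digraph \<Rightarrow> 'a subdiv_vertex pair_pre_digraph" where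
  "s_subdivision s G =
    \<lparr> pverts = Orig ` pverts G \<union>
        {subdiv_point s u v i | u v i. (u, v) \<in> parcs G \<and> 1 \<le> i \<and> i \<le> s},
      parcs = {(subdiv_point s u v i, subdiv_point s u v (i + 1)) | u v i.
        (u, v) \<in> parcs G \<and> i \<le> s} \<rparr>"

lemma subdiv_point_rev: "i \<le> s + 1 \<Longrightarrow> subdiv_point s v u (s + 1 - i) = subdiv_point s u v i"
  by (auto simp: subdiv_point_def)

lemma subdiv_point_inner_eq_iff:
  assumes "u \<noteq> v" "1 \<le> i" "i \<le> s" "1 \<le> j" "j \<le> s"
  shows "subdiv_point s u v i = subdiv_point s u' v' j \<longleftrightarrow>
    (u' = u \<and> v' = v \<and> j = i) \<or> (u' = v \<and> v' = u \<and> j = s + 1 - i)"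
  using assms by (auto simp: subdiv_point_def doubleton_eq_iff)

lemma pair_graph_s_subdivision:
  assumes "pair_graph G"
  shows "pair_graph (s_subdivision s G)"
proof -
  interpret pair_graph G by fact
  have pt: "subdiv_point s u v i \<in> pverts (s_subdivision s G)"
    if uv: "(u, v) \<in> parcs G" and i: "i \<le> s + 1" for u v i
  proof -
    have "u \<in> pverts G" "v \<in> pverts G" using uv by (auto dest: wellformed')
    consider "i = 0" | "i = s + 1" | "1 \<le> i" "i \<le> s" using i by fastforce
    then show ?thesis
    proof cases
      case 3
      then show ?thesis using uv unfolding s_subdivision_def by auto
    qed (use \<open>u \<in> pverts G\<close> \<open>v \<in> pverts G\<close> in \<open>auto simp: s_subdivision_def subdiv_point_def\<close>)
  qed
  show ?thesis
  proof
    fix e assume "e \<in> parcs (s_subdivision s G)"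
    then obtain u v i where e: "(u, v) \<in> parcs G" "i \<le> s"
      "e = (subdiv_point s u v i, subdiv_point s u v (i + 1))"
      by (auto simp: s_subdivision_def)
    show "fst e \<in> pverts (s_subdivision s G)" using pt[of u v i] e by simp
    show "snd e \<in> pverts (s_subdivision s G)" using pt[of u v "i + 1"] e by simp
    have "u \<noteq> v" using e(1) pair_no_loops by force
    then show "fst e \<noteq> snd e"
      using e(2) unfolding e(3) by (auto simp: subdiv_point_def doubleton_eq_iff)
  next
    have "{subdiv_point s u v i | u v i. (u, v) \<in> parcs G \<and> 1 \<le> i \<and> i \<le> s}
        \<subseteq> (\<lambda>((u, v), i). subdiv_point s u v i) ` (parcs G \<times> {..s})"
      by force
    then have "finite {subdiv_point s u v i | u v i. (u, v) \<in> parcs G \<and> 1 \<le> i \<and> i \<le> s}"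
      by (rule finite_subset) (use pair_finite_arcs in auto)
    then show "finite (pverts (s_subdivision s G))"
      using pair_finite_verts by (simp add: s_subdivision_def)
    have "parcs (s_subdivision s G) \<subseteq>
        (\<lambda>((u, v), i). (subdiv_point s u v i, subdiv_point s u v (i + 1))) ` (parcs G \<times> {..s})"
      by (force simp: s_subdivision_def)
    then show "finite (parcs (s_subdivision s G))"
      by (rule finite_subset) (use pair_finite_arcs in auto)
  next
    have "(y, x) \<in> parcs (s_subdivision s G)" if xy: "(x, y) \<in> parcs (s_subdivision s G)" for x y
    proof -
      obtain u v i where e: "(u, v) \<in> parcs G" "i \<le> s"
        "x = subdiv_point s u v i" "y = subdiv_point s u v (i + 1)"
        using xy by (auto simp: s_subdivision_def)
      have "(v, u) \<in> parcs G" using e(1) pair_sym_arcs by (auto simp: symmetric_def dest: symD)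
      moreover have "y = subdiv_point s v u (s - i)"
        using subdiv_point_rev[of "i + 1" s v u] e by simp
      moreover have "x = subdiv_point s v u (s - i + 1)"
        using subdiv_point_rev[of i s v u] e by (simp add: Suc_diff_le)
      ultimately show ?thesis unfolding s_subdivision_def by force
    qed
    then show "symmetric (with_proj (s_subdivision s G))"
      by (auto simp: symmetric_def intro: symI)
  qed
qed

text \<open>
  Loops created by a flip with intersecting sides are kept; they do not affect distances.
\<close>

definition flip :: "'a set \<times> 'a set \<Rightarrow> 'a pair_pre_digraph \<Rightarrow> 'a pair_pre_digraph" where
  "flip F G = \<lparr> pverts = pverts G,
    parcs = sym_diff (parcs G) (fst F \<times> snd F \<union> snd F \<times> fst F) \<rparr>"

lemma comp_fun_commute_flip: "comp_fun_commute flip"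
  by unfold_locales (auto simp: flip_def fun_eq_iff)

text \<open>
  The order in which the flips are applied is irrelevant by the preceding lemma, so the fold is
  well-defined on finite sets of flips.
\<close>

definition flips :: "('a set \<times> 'a set) set \<Rightarrow> 'a pair_pre_digraph \<Rightarrow> 'a pair_pre_digraph" where
  "flips \<F> G = Finite_Set.fold flip G \<F>"

lemma flips_empty: "flips {} G = G"
  by (simp add: flips_def)

lemma flips_insert:
  assumes "finite \<F>" "F \<notin> \<F>"
  shows "flips (insert F \<F>) G = flip F (flips \<F> G)"
proof -
  interpret comp_fun_commute flip by (rule comp_fun_commute_flip)
  show ?thesis using assms by (simp add: flips_def)
qed

definition graph_dist :: "'a pair_pre_digraph \<Rightarrow> 'a \<Rightarrow> 'a \<Rightarrow> enat" where
  "graph_dist G u v = (INF p \<in> {p. pre_digraph.awalk (with_proj G) u p v}. enat (length p))"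

definition r_independent :: "nat \<Rightarrow> 'a pair_pre_digraph \<Rightarrow> 'a set \<Rightarrow> bool" where
  "r_independent r G B \<longleftrightarrow>
    B \<subseteq> pverts G \<and> (\<forall>u\<in>B. \<forall>v\<in>B. u \<noteq> v \<longrightarrow> graph_dist G u v > enat r)"

text \<open>
  The following is meant for classes of finite graphs: cardinalities are measured by \<^const>\<open>card\<close>.
\<close>

definition strongly_flip_flat :: "'a pair_pre_digraph set \<Rightarrow> bool" where
  "strongly_flip_flat \<C> \<longleftrightarrow>
    (\<exists>s\<^sub>0::nat. \<forall>r::nat. \<exists>N::nat \<Rightarrow> nat. \<forall>m::nat. \<forall>G\<in>\<C>. \<forall>A. A \<subseteq> pverts G \<and> card A \<ge> N m \<longrightarrow>
      (\<exists>\<F> B. \<F> \<subseteq> Pow (pverts G) \<times> Pow (pverts G) \<and> finite \<F> \<and> card \<F> \<le> s\<^sub>0 \<and>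
        B \<subseteq> A \<and> card B \<ge> m \<and> r_independent r (flips \<F> G) B))"

lemma pair_graph_s_subdivision_complete_bipartite: "pair_graph (s_subdivision s (complete_bipartite m n))"
  by (rule pair_graph_s_subdivision,
      rule pair_graphI_complete_bipartite[OF complete_bipartite_digraph_complete_bipartite])

end

theory Submission
  imports Defs
begin

text \<open>
  Given \<open>s\<^sub>0\<close>, take \<open>s = 4 ^ s\<^sub>0 + 1\<close> and \<open>r = 2 * s + 2\<close>, and let \<open>A\<close> be the side of size \<open>N\<close>.
  At most \<open>s\<^sub>0\<close> flips \<open>\<F>\<close> split the vertices into at most \<open>4 ^ s\<^sub>0\<close> types, and whether they toggle a
  pair depends only on the two types. By pigeonhole, a large \<open>B \<subseteq> A\<close> contains three vertices \<open>b\<^sub>1\<close>,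
  \<open>b\<^sub>2\<close>, \<open>b\<^sub>3\<close> such that the types along the subdivided path from the \<open>i\<close>-th hub to \<open>b\<^sub>j\<close> do not
  depend on \<open>j\<close>. Walk from the \<open>b\<^sub>j\<close> towards a hub. If two consecutive layers are toggled, then a
  vertex on the third path is a common neighbour of vertices on the first two; otherwise the paths
  survive, so one gets within distance 1 of every hub. If all edges at the hubs are toggled away, two
  hubs of the same type exist, and each is then joined to all the paths of the other.
  In every case \<open>b\<^sub>1\<close> and \<open>b\<^sub>2\<close> are at distance at most \<open>2 * s + 2\<close>.
\<close>

section \<open>Walks and flips\<close>

lemma awalk_of_relpow:
  assumes "(u, v) \<in> parcs G ^^ n" "u \<in> pverts G"
  shows "\<exists>p. pre_digraph.awalk (with_proj G) u p v \<and> length p = n"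
proof -
  have "\<exists>p. set p \<subseteq> parcs G \<and> pre_digraph.cas (with_proj G) u p v \<and> length p = n"
    using assms(1)
  proof (induction n arbitrary: u)
    case 0
    then show ?case by (auto simp: pre_digraph.cas.simps)
  next
    case (Suc n)
    then obtain w where w: "(u, w) \<in> parcs G" "(w, v) \<in> parcs G ^^ n"
      by (meson relpow_Suc_D2)
    then obtain p where "set p \<subseteq> parcs G" "pre_digraph.cas (with_proj G) w p v" "length p = n"
      using Suc.IH by blast
    with w(1) show ?case
      by (intro exI[of _ "(u, w) # p"]) (auto simp: pre_digraph.cas.simps)
  qed
  with assms(2) show ?thesis by (auto simp: pre_digraph.awalk_def)
qed

lemma graph_dist_le_of_relpow:
  assumes "(u, v) \<in> parcs G ^^ n" "u \<in> pverts G"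
  shows "graph_dist G u v \<le> enat n"
proof -
  obtain p where "pre_digraph.awalk (with_proj G) u p v" "length p = n"
    using awalk_of_relpow[OF assms] by blast
  then show ?thesis unfolding graph_dist_def by (intro INF_lower2[of p]) auto
qed

lemma sym_relpow:
  assumes "sym R"
  shows "sym (R ^^ n)"
proof (induction n)
  case (Suc n)
  show ?case
  proof (rule symI)
    fix x y assume "(x, y) \<in> R ^^ Suc n"
    then obtain z where "(x, z) \<in> R ^^ n" "(z, y) \<in> R" by auto
    then have "(y, z) \<in> R" "(z, x) \<in> R ^^ n"
      using assms Suc by (auto dest: symD)
    then show "(y, x) \<in> R ^^ Suc n" by (rule relpow_Suc_I2)
  qed
qed (auto intro: symI)

text \<open>Extend both walks to \<open>z\<close>, reverse the second by symmetry and concatenate: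
  two halves of length \<open>Suc d\<close>.\<close>

lemma relpow_common_neighbour:
  assumes "sym R" "(b, x) \<in> R ^^ d" "(c, y) \<in> R ^^ d" "(x, z) \<in> R" "(y, z) \<in> R"
  shows "(b, c) \<in> R ^^ (2 * d + 2)"
proof -
  have 1: "(b, z) \<in> R ^^ Suc d" using assms by auto
  have "(c, z) \<in> R ^^ Suc d" using assms by auto
  then have "(z, c) \<in> R ^^ Suc d" using sym_relpow[OF assms(1)] by (meson symD)
  with 1 have "(b, c) \<in> R ^^ (Suc d + Suc d)" unfolding relpow_add by blast
  then show ?thesis by (metis add_2_eq_Suc' add_Suc add_Suc_right mult_2)
qed

lemma sym_parcs_flips:
  "finite \<F> \<Longrightarrow> sym (parcs G) \<Longrightarrow> sym (parcs (flips \<F> G))"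
  by (induction \<F> rule: finite_induct)
    (auto simp: flips_empty flips_insert flip_def sym_def)

text \<open>The two sides are recorded separately because they may overlap: each flip leaves four
  possibilities for a vertex, which gives the count \<open>4 ^ card \<F>\<close>.\<close>

definition flip_type :: "('a set \<times> 'a set) set \<Rightarrow> 'a \<Rightarrow> ('a set \<times> 'a set) set \<times> ('a set \<times> 'a set) set"
  where "flip_type \<F> x = ({F \<in> \<F>. x \<in> fst F}, {F \<in> \<F>. x \<in> snd F})"

text \<open>For finite \<open>\<F>\<close> this says that an odd number of flips cover the pair;
  comparing adjacency before and after avoids counting them.\<close>

definition toggled :: "('a set \<times> 'a set) set \<Rightarrow> 'a pair_pre_digraph \<Rightarrow> 'a \<Rightarrow> 'a \<Rightarrow> bool"
  where "toggled \<F> G x y \<longleftrightarrow> ((x, y) \<in> parcs (flips \<F> G)) \<noteq> ((x, y) \<in> parcs G)"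

text \<open>Whether a single flip covers a pair is decided by the memberships of its two ends, which
  the types record; induction adds one flip at a time.\<close>

lemma toggled_cong:
  assumes "finite \<F>" "flip_type \<F> x = flip_type \<F> x'" "flip_type \<F> y = flip_type \<F> y'"
  shows "toggled \<F> G x y \<longleftrightarrow> toggled \<F> G x' y'"
  using assms
proof (induction \<F> rule: finite_induct)
  case empty
  then show ?case by (simp add: toggled_def flips_empty)
next
  case (insert F \<F>)
  have mem: "F' \<in> insert F \<F> \<Longrightarrow> (x \<in> fst F' \<longleftrightarrow> x' \<in> fst F') \<and> (x \<in> snd F' \<longleftrightarrow> x' \<in> snd F') \<and>
      (y \<in> fst F' \<longleftrightarrow> y' \<in> fst F') \<and> (y \<in> snd F' \<longleftrightarrow> y' \<in> snd F')" for F'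
    using insert.prems unfolding flip_type_def by blast
  have "flip_type \<F> x = flip_type \<F> x'" "flip_type \<F> y = flip_type \<F> y'"
    using mem by (auto simp: flip_type_def)
  then have "toggled \<F> G x y \<longleftrightarrow> toggled \<F> G x' y'" by (rule insert.IH)
  then show ?case
    using mem[of F] insert.hyps by (auto simp: toggled_def flips_insert flip_def)
qed

lemma flip_type_in: "flip_type \<F> x \<in> Pow \<F> \<times> Pow \<F>"
  by (auto simp: flip_type_def)

lemma card_flip_types: "finite \<F> \<Longrightarrow> card (Pow \<F> \<times> Pow \<F>) = 4 ^ card \<F>"
  by (simp add: card_cartesian_product card_Pow flip: power_mult_distrib)

section \<open>Subdivided complete bipartite graphs\<close>

abbreviation subdiv_K :: "nat \<Rightarrow> nat \<Rightarrow> (nat + nat) subdiv_vertex pair_pre_digraph" where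
  "subdiv_K s n \<equiv> s_subdivision s (complete_bipartite s n)"

abbreviation path_vertex :: "nat \<Rightarrow> nat \<Rightarrow> nat \<Rightarrow> nat \<Rightarrow> (nat + nat) subdiv_vertex" where
  "path_vertex s i j k \<equiv> subdiv_point s (Inl i) (Inr j) k"

lemma sym_parcs_subdiv_K: "sym (parcs (subdiv_K s n))"
proof -
  interpret pair_graph "subdiv_K s n" by (rule pair_graph_s_subdivision_complete_bipartite)
  show ?thesis using pair_sym_arcs by (simp add: symmetric_def)
qed

lemma path_vertex_adjacent:
  assumes "i < s" "j < n" "k \<le> s"
  shows "(path_vertex s i j (Suc k), path_vertex s i j k) \<in> parcs (subdiv_K s n)"
proof (rule symD[OF sym_parcs_subdiv_K])
  show "(path_vertex s i j k, path_vertex s i j (Suc k)) \<in> parcs (subdiv_K s n)"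
    using assms by (force simp: s_subdivision_def complete_bipartite_def)
qed

text \<open>The guards exclude the shared ends: position 0 is the hub and forgets \<open>j\<close>,
  position \<open>s + 1\<close> is \<open>Orig (Inr j)\<close> and forgets \<open>i\<close>.\<close>

lemma path_vertex_eqD:
  assumes "path_vertex s i j k = path_vertex s i' j' l" "k \<le> s + 1" "l \<le> s + 1"
  shows "1 \<le> k \<Longrightarrow> j = j'" "k \<le> s \<Longrightarrow> i = i'"
  using assms by (simp_all add: subdiv_point_def doubleton_eq_iff split: if_splits)

text \<open>Both ends of an arc lie on one path, read from the hub whatever the orientation of the
  underlying arc. Non-adjacency then follows by comparing path indices.\<close>

lemma parcs_subdiv_KD:
  assumes "(x, y) \<in> parcs (subdiv_K s n)"
  obtains i j l l' where "l \<le> s + 1" "l' \<le> s + 1" "x = path_vertex s i j l" "y = path_vertex s i j l'"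
proof -
  obtain u v l where uv: "(u, v) \<in> parcs (complete_bipartite s n)" and l: "l \<le> s"
    and xy: "x = subdiv_point s u v l" "y = subdiv_point s u v (l + 1)"
    using assms by (auto simp: s_subdivision_def)
  from uv consider i j where "u = Inl i" "v = Inr j" | i j where "u = Inr j" "v = Inl i"
    by (auto simp: complete_bipartite_def)
  then show thesis
  proof cases
    case 1
    with l xy show thesis by (intro that[of l "l + 1"]) auto
  next
    case (2 i j)
    have "x = path_vertex s i j (s + 1 - l)" "y = path_vertex s i j (s + 1 - (l + 1))"
      using 2 l xy subdiv_point_rev[of l s v u] subdiv_point_rev[of "l + 1" s v u] by simp_all
    then show thesis by (intro that) auto
  qed
qed

lemma path_vertex_not_adjacent:
  assumes "j \<noteq> j'" "1 \<le> k" "k \<le> s"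
  shows "(path_vertex s i j (Suc k), path_vertex s i j' k) \<notin> parcs (subdiv_K s n)"
proof
  assume "(path_vertex s i j (Suc k), path_vertex s i j' k) \<in> parcs (subdiv_K s n)"
  then obtain i0 j0 l l' where l: "l \<le> s + 1" "l' \<le> s + 1"
    and eq: "path_vertex s i j (Suc k) = path_vertex s i0 j0 l"
      "path_vertex s i j' k = path_vertex s i0 j0 l'"
    by (rule parcs_subdiv_KD)
  have "j = j0" "j' = j0"
    using path_vertex_eqD(1)[OF eq(1) _ l(1)] path_vertex_eqD(1)[OF eq(2) _ l(2)] assms by simp_all
  with assms(1) show False by simp
qed

lemma path_vertex_hub_not_adjacent:
  assumes "i \<noteq> i'" "1 \<le> s"
  shows "(path_vertex s i j 1, path_vertex s i' j' 0) \<notin> parcs (subdiv_K s n)"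
proof
  assume "(path_vertex s i j 1, path_vertex s i' j' 0) \<in> parcs (subdiv_K s n)"
  then obtain i0 j0 l l' where l: "l \<le> s + 1" "l' \<le> s + 1"
    and eq: "path_vertex s i j 1 = path_vertex s i0 j0 l"
      "path_vertex s i' j' 0 = path_vertex s i0 j0 l'"
    by (rule parcs_subdiv_KD)
  have "i = i0" "i' = i0"
    using path_vertex_eqD(2)[OF eq(1) _ l(1)] path_vertex_eqD(2)[OF eq(2) _ l(2)] assms by simp_all
  with assms(1) show False by simp
qed

text \<open>The existential \<open>d\<close> is the depth at which two parallel descents acquire a
  common neighbour. The path to \<open>j3\<close> must differ from both others so that its edges to
  them can only come from flips.\<close>

lemma walk_between_equal_path_types:
  fixes s n :: nat
  defines "G \<equiv> subdiv_K s n"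
  assumes fin: "finite \<F>" and few: "4 ^ card \<F> < s"
    and j: "j1 < n" "j2 < n" "j1 \<noteq> j3" "j2 \<noteq> j3"
    and eq2: "\<And>i k. i < s \<Longrightarrow> k \<le> s + 1 \<Longrightarrow>
      flip_type \<F> (path_vertex s i j2 k) = flip_type \<F> (path_vertex s i j1 k)"
    and eq3: "\<And>i k. i < s \<Longrightarrow> k \<le> s + 1 \<Longrightarrow>
      flip_type \<F> (path_vertex s i j3 k) = flip_type \<F> (path_vertex s i j1 k)"
  shows "\<exists>d\<le>s. (Orig (Inr j1), Orig (Inr j2)) \<in> parcs (flips \<F> G) ^^ (2 * d + 2)"
proof (rule ccontr)
  assume neg: "\<not> ?thesis"
  define R where "R = parcs (flips \<F> G)"
  have R: "sym R"
    unfolding R_def G_def by (rule sym_parcs_flips[OF fin sym_parcs_subdiv_K])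
  \<comment> \<open>Every case below is refuted by exhibiting a common neighbour of two walk ends at
    equal depth.\<close>
  have no_common: False
    if "d \<le> s" "(Orig (Inr j1), x) \<in> R ^^ d" "(Orig (Inr j2), y) \<in> R ^^ d"
      "(x, z) \<in> R" "(y, z) \<in> R" for d x y z
    using relpow_common_neighbour[OF R that(2-)] neg that(1) unfolding R_def by blast
  \<comment> \<open>The descent stops at position 1: at position 0 the paths for different
    \<open>j\<close> meet in the hub, so \<open>path_vertex_not_adjacent\<close> no longer
    applies.\<close>
  have reach: "(Orig (Inr j1), path_vertex s i j1 (s + 1 - d)) \<in> R ^^ d \<and>
      (Orig (Inr j2), path_vertex s i j2 (s + 1 - d)) \<in> R ^^ d"
    if "i < s" "d \<le> s" for i d
    using that(2)
  proof (induction d)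
    case 0
    then show ?case by (auto simp: subdiv_point_def)
  next
    case (Suc d)
    define k where "k = s - d"
    have k: "1 \<le> k" "k \<le> s" "s + 1 - d = Suc k" "s + 1 - Suc d = k"
      using Suc.prems by (auto simp: k_def)
    have IH: "(Orig (Inr j1), path_vertex s i j1 (Suc k)) \<in> R ^^ d"
        "(Orig (Inr j2), path_vertex s i j2 (Suc k)) \<in> R ^^ d"
      using Suc k by auto
    have types: "flip_type \<F> (path_vertex s i j2 l) = flip_type \<F> (path_vertex s i j1 l)"
        "flip_type \<F> (path_vertex s i j3 l) = flip_type \<F> (path_vertex s i j1 l)"
      if "l \<in> {k, Suc k}" for l
      using that k eq2[OF \<open>i < s\<close>] eq3[OF \<open>i < s\<close>] by auto
    let ?T = "toggled \<F> G"
    have T: "?T (path_vertex s i j1 (Suc k)) (path_vertex s i j3 k) \<longleftrightarrow>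
          ?T (path_vertex s i j1 (Suc k)) (path_vertex s i j1 k)"
        "?T (path_vertex s i j2 (Suc k)) (path_vertex s i j3 k) \<longleftrightarrow>
          ?T (path_vertex s i j1 (Suc k)) (path_vertex s i j1 k)"
        "?T (path_vertex s i j2 (Suc k)) (path_vertex s i j2 k) \<longleftrightarrow>
          ?T (path_vertex s i j1 (Suc k)) (path_vertex s i j1 k)"
      by (rule toggled_cong[OF fin]; simp add: types)+
    have nT: "\<not> ?T (path_vertex s i j1 (Suc k)) (path_vertex s i j1 k)"
    proof
      assume "?T (path_vertex s i j1 (Suc k)) (path_vertex s i j1 k)"
      then have "(path_vertex s i j1 (Suc k), path_vertex s i j3 k) \<in> R"
          "(path_vertex s i j2 (Suc k), path_vertex s i j3 k) \<in> R"
        using T path_vertex_not_adjacent[OF j(3) k(1,2)] path_vertex_not_adjacent[OF j(4) k(1,2)]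
        by (auto simp: toggled_def R_def G_def)
      with no_common[OF _ IH] Suc.prems show False by simp
    qed
    then have "(path_vertex s i j1 (Suc k), path_vertex s i j1 k) \<in> R"
        "(path_vertex s i j2 (Suc k), path_vertex s i j2 k) \<in> R"
      using T path_vertex_adjacent[OF \<open>i < s\<close> j(1) k(2)] path_vertex_adjacent[OF \<open>i < s\<close> j(2) k(2)]
      by (auto simp: toggled_def R_def G_def)
    with IH show ?case unfolding k(4) by auto
  qed
  have s: "1 \<le> s" using few by simp
  let ?hub = "\<lambda>i. path_vertex s i j1 0"
  have hub: "path_vertex s i j2 0 = ?hub i" for i by (simp add: subdiv_point_def)
  have near: "(Orig (Inr j1), path_vertex s i j1 1) \<in> R ^^ s"
      "(Orig (Inr j2), path_vertex s i j2 1) \<in> R ^^ s" if "i < s" for i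
    using reach[OF that, of s] by auto
  have T2: "toggled \<F> G (path_vertex s i j2 1) h \<longleftrightarrow> toggled \<F> G (path_vertex s i j1 1) h"
    if "i < s" for i h
    by (rule toggled_cong[OF fin]) (use eq2[OF that] s in auto)
  \<comment> \<open>Otherwise both final edges survive and the hub itself is the common
    neighbour.\<close>
  have T: "toggled \<F> G (path_vertex s i j1 1) (?hub i)" if "i < s" for i
  proof (rule ccontr)
    assume "\<not> ?thesis"
    then have "(path_vertex s i j1 1, ?hub i) \<in> R" "(path_vertex s i j2 1, ?hub i) \<in> R"
      using T2[OF that] path_vertex_adjacent[OF that j(1), of 0]
        path_vertex_adjacent[OF that j(2), of 0] hub
      by (auto simp: toggled_def R_def G_def)
    with no_common[OF _ near[OF that]] show False by simp
  qed
  have "\<not> inj_on (\<lambda>i. flip_type \<F> (?hub i)) {..<s}"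
  proof
    assume inj: "inj_on (\<lambda>i. flip_type \<F> (?hub i)) {..<s}"
    have "card {..<s} \<le> card (Pow \<F> \<times> Pow \<F>)"
      by (rule card_inj_on_le[OF inj]) (intro image_subsetI flip_type_in, simp add: fin)
    with few card_flip_types[OF fin] show False by simp
  qed
  then obtain i i' where i: "i < s" "i' < s" "i \<noteq> i'" "flip_type \<F> (?hub i) = flip_type \<F> (?hub i')"
    by (auto simp: inj_on_def)
  \<comment> \<open>Equal types transfer the toggle from hub \<open>i\<close> to hub
    \<open>i'\<close>, where no edge was present, so the flips create one.\<close>
  have "toggled \<F> G (path_vertex s i j1 1) (?hub i')"
    using T[OF i(1)] toggled_cong[OF fin refl i(4)] by blast
  then have "(path_vertex s i j1 1, ?hub i') \<in> R" "(path_vertex s i j2 1, ?hub i') \<in> R"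
    using T2[OF i(1)] path_vertex_hub_not_adjacent[OF i(3) s]
    by (auto simp: toggled_def R_def G_def)
  with no_common[OF _ near[OF i(1)]] show False by simp
qed

section \<open>Pigeonhole and the final contradiction\<close>

lemma pigeonhole_three:
  assumes "finite C" "f ` J \<subseteq> C" "2 * card C < card J"
  obtains x y z where "x \<in> J" "y \<in> J" "z \<in> J" "x \<noteq> y" "x \<noteq> z" "y \<noteq> z" "f y = f x" "f z = f x"
proof -
  have "\<exists>c\<in>C. 3 \<le> card {x \<in> J. f x = c}"
  proof (rule ccontr)
    assume neg: "\<not> ?thesis"
    have "J = (\<Union>c\<in>C. {x \<in> J. f x = c})" using assms(2) by auto
    then have "card J \<le> (\<Sum>c\<in>C. card {x \<in> J. f x = c})"
      by (metis card_UN_le[OF assms(1)])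
    also have "\<dots> \<le> (\<Sum>c\<in>C. 2)" by (rule sum_mono) (use neg in force)
    finally show False using assms(3) by simp
  qed
  then obtain c where "3 \<le> card {x \<in> J. f x = c}" by blast
  then obtain S where "S \<subseteq> {x \<in> J. f x = c}" "card S = 3"
    by (meson obtain_subset_with_card_n)
  then obtain x y z where "{x, y, z} \<subseteq> {x \<in> J. f x = c}" "x \<noteq> y" "x \<noteq> z" "y \<noteq> z"
    by (auto simp: card_3_iff)
  then show thesis by (intro that[of x y z]) auto
qed

theorem mainTheorem5:
  shows "\<not> strongly_flip_flat {s_subdivision s (complete_bipartite s N) | (s::nat) (N::nat). True}"
proof
  assume "strongly_flip_flat {s_subdivision s (complete_bipartite s N) | (s::nat) (N::nat). True}"
  then obtain s0 where s0: "\<forall>r. \<exists>N. \<forall>m.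
      \<forall>G\<in>{s_subdivision s (complete_bipartite s N) | (s::nat) (N::nat). True}.
      \<forall>A. A \<subseteq> pverts G \<and> card A \<ge> N m \<longrightarrow>
      (\<exists>\<F> B. \<F> \<subseteq> Pow (pverts G) \<times> Pow (pverts G) \<and> finite \<F> \<and> card \<F> \<le> s0 \<and>
        B \<subseteq> A \<and> card B \<ge> m \<and> r_independent r (flips \<F> G) B)"
    unfolding strongly_flip_flat_def by (elim exE)
  \<comment> \<open>There are more hubs than types. The exponent \<open>s * (s + 2)\<close> in
    \<open>m\<close> counts the pairs of a hub and a position in \<open>{..s + 1}\<close>; the
    factor 2 and the added 1 force three equal type tables.\<close>
  define s :: nat where "s = 4 ^ s0 + 1"
  define m :: nat where "m = 2 * (4 ^ s0) ^ (s * (s + 2)) + 1"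
  \<comment> \<open>The radius may depend on \<open>s\<close> because \<open>s0\<close> is fixed
    before \<open>r\<close>; it is the largest \<open>2 * d + 2\<close> with
    \<open>d \<le> s\<close>.\<close>
  from s0[rule_format, of "2 * s + 2"] obtain N where N: "\<forall>m.
      \<forall>G\<in>{s_subdivision s (complete_bipartite s N) | (s::nat) (N::nat). True}.
      \<forall>A. A \<subseteq> pverts G \<and> card A \<ge> N m \<longrightarrow>
      (\<exists>\<F> B. \<F> \<subseteq> Pow (pverts G) \<times> Pow (pverts G) \<and> finite \<F> \<and> card \<F> \<le> s0 \<and>
        B \<subseteq> A \<and> card B \<ge> m \<and> r_independent (2 * s + 2) (flips \<F> G) B)"
    by (elim exE)
  define n where "n = N m"
  define A :: "(nat + nat) subdiv_vertex set" where "A = (\<lambda>j. Orig (Inr j)) ` {..<n}"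
  have inj: "inj_on (\<lambda>j. Orig (Inr j) :: (nat + nat) subdiv_vertex) X" for X
    by (auto simp: inj_on_def)
  have G: "subdiv_K s n \<in> {s_subdivision s (complete_bipartite s N) | (s::nat) (N::nat). True}"
    by (rule CollectI, rule exI[of _ s], rule exI[of _ n]) simp
  have "A \<subseteq> pverts (subdiv_K s n)"
    by (auto simp: A_def s_subdivision_def complete_bipartite_def)
  moreover have "card A \<ge> N m" by (simp add: A_def card_image[OF inj] n_def)
  ultimately have "\<exists>\<F> B. \<F> \<subseteq> Pow (pverts (subdiv_K s n)) \<times> Pow (pverts (subdiv_K s n)) \<and>
      finite \<F> \<and> card \<F> \<le> s0 \<and> B \<subseteq> A \<and> card B \<ge> m \<and>
      r_independent (2 * s + 2) (flips \<F> (subdiv_K s n)) B"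
    using N[rule_format, OF G] by simp
  then obtain \<F> B where fin: "finite \<F>" and few: "card \<F> \<le> s0"
    and B: "B \<subseteq> A" "card B \<ge> m"
    and indep: "r_independent (2 * s + 2) (flips \<F> (subdiv_K s n)) B"
    by (elim exE conjE)
  obtain J where J: "J \<subseteq> {..<n}" "B = (\<lambda>j. Orig (Inr j)) ` J"
    using B(1) by (auto simp: A_def subset_image_iff)
  have types: "(4::nat) ^ card \<F> \<le> 4 ^ s0" using few by (simp add: power_increasing)
  let ?I = "{..<s} \<times> {..s + 1}"
  define C where "C = ?I \<rightarrow>\<^sub>E (Pow \<F> \<times> Pow \<F>)"
  \<comment> \<open>The table of types along all paths ending at \<open>j\<close>, restricted to
    \<open>?I\<close> so that the possible tables form the finite set \<open>C\<close>.\<close>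
  define f where "f j = (\<lambda>(i, k)\<in>?I. flip_type \<F> (path_vertex s i j k))" for j
  have "finite C" unfolding C_def using fin by (intro finite_PiE) auto
  moreover have "f ` J \<subseteq> C"
    unfolding C_def f_def by (intro image_subsetI restrict_PiE_iff[THEN iffD2])
      (auto simp only: split_paired_all case_prod_conv flip_type_in)
  moreover have "2 * card C < card J"
  proof -
    have "card C = (4 ^ card \<F>) ^ (s * (s + 2))"
      unfolding C_def by (simp add: card_PiE card_flip_types[OF fin] del: card_cartesian_product)
    also have "\<dots> \<le> (4 ^ s0) ^ (s * (s + 2))" by (rule power_mono[OF types]) simp
    finally show ?thesis using B(2) unfolding J(2) card_image[OF inj] m_def by linarith
  qed
  ultimately obtain j1 j2 j3 where j: "j1 \<in> J" "j2 \<in> J" "j3 \<in> J" "j1 \<noteq> j2" "j1 \<noteq> j3" "j2 \<noteq> j3"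
    and f: "f j2 = f j1" "f j3 = f j1"
    by (rule pigeonhole_three)
  have eq: "flip_type \<F> (path_vertex s i j k) = flip_type \<F> (path_vertex s i j1 k)"
    if "f j = f j1" "i < s" "k \<le> s + 1" for i j k
    using fun_cong[OF that(1), of "(i, k)"] that(2,3) by (simp add: f_def)
  have "\<exists>d\<le>s. (Orig (Inr j1), Orig (Inr j2)) \<in> parcs (flips \<F> (subdiv_K s n)) ^^ (2 * d + 2)"
  proof (rule walk_between_equal_path_types[OF fin])
    show "4 ^ card \<F> < s" using types unfolding s_def by linarith
    show "j1 < n" "j2 < n" using j J(1) by auto
  qed (fact j(5) j(6) eq[OF f(1)] eq[OF f(2)])+
  then obtain d where d: "d \<le> s"
      "(Orig (Inr j1), Orig (Inr j2)) \<in> parcs (flips \<F> (subdiv_K s n)) ^^ (2 * d + 2)"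
    by blast
  have inB: "Orig (Inr j1) \<in> B" "Orig (Inr j2) \<in> B" using j J(2) by auto
  then have "Orig (Inr j1) \<in> pverts (flips \<F> (subdiv_K s n))"
    using indep unfolding r_independent_def by blast
  from graph_dist_le_of_relpow[OF d(2) this]
  have "graph_dist (flips \<F> (subdiv_K s n)) (Orig (Inr j1)) (Orig (Inr j2)) \<le> enat (2 * s + 2)"
    by (rule order_trans) (use d(1) in simp)
  moreover have "graph_dist (flips \<F> (subdiv_K s n)) (Orig (Inr j1)) (Orig (Inr j2)) > enat (2 * s + 2)"
    using indep inB j(4) by (simp add: r_independent_def del: enat_ord_simps)
  ultimately show False by simp
qed

end
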